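(* Let $a$ and $m$ be relatively prime positive integers with $m>1$, and let $n=am+1$. Suppose that $n$ has the property that if $m\mid\varphi(n)$ then $n$ is prime. If for each prime $q$ dividing $m$ there exists an integer $b_q$ such that $b_q^{\,n-1}\equiv 1\pmod n$ and $b_q^{\,(n-1)/q}\not\equiv 1\pmod n$, then $n$ is prime.
   Context: $\varphi$ denotes Euler's totient function. *)

theory Defs
  imports "HOL-Number_Theory.Number_Theory"
begin

end

(* For each prime q dividing m, the order of b_q modulo n divides n - 1 but not (n - 1) / q, so it
   contains the full power of q in n - 1, hence that of q in m.  As the order divides totient n,
   all these prime powers together give m dvd totient n. *)

theory Submission
  imports Defs
begin

text \<open>Write \<open>k = d * e\<close>. If \<open>q\<close> divided \<open>e\<close>, then
  \<open>k div q = d * (e div q)\<close> would be a multiple of \<open>d\<close>; so the cofactor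
  \<open>e\<close> contributes no factor \<open>q\<close>.\<close>

lemma multiplicity_eq_if_not_dvd_div:
  fixes d k q :: nat
  assumes "prime q" "k > 0" "d dvd k" "\<not> d dvd k div q"
  shows "multiplicity q d = multiplicity q k"
proof -
  from \<open>d dvd k\<close> obtain e where e: "k = d * e" ..
  have "\<not> q dvd e"
    using assms(1,4) e by (auto simp: prime_gt_0_nat div_mult_swap [symmetric])
  moreover have "d \<noteq> 0" "e \<noteq> 0" using e \<open>k > 0\<close> by auto
  ultimately show ?thesis
    using assms(1) e
    by (simp add: prime_elem_multiplicity_mult_distrib not_dvd_imp_multiplicity_0)
qed

text \<open>Carries \<open>ord_divides\<close>, stated over the naturals, to an integer base. For
  positive \<open>n\<close> the residue \<open>b mod int n\<close> is nonnegative, so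
  \<open>nat\<close> does not change its value.\<close>

lemma int_power_cong_1_iff_ord_dvd:
  fixes b :: int and n k :: nat
  assumes "n > 0"
  shows "[b ^ k = 1] (mod int n) \<longleftrightarrow> ord n (nat (b mod int n)) dvd k"
proof -
  have "[b ^ k = 1] (mod int n) \<longleftrightarrow> [int (nat (b mod int n)) ^ k = 1] (mod int n)"
    using assms by (simp add: cong_def power_mod)
  also have "\<dots> \<longleftrightarrow> [nat (b mod int n) ^ k = 1] (mod n)"
    using cong_int_iff [of "nat (b mod int n) ^ k" 1 n] by (simp only: of_nat_power of_nat_1)
  finally show ?thesis by (simp only: ord_divides)
qed

theorem theorem4p1:
  fixes a m n :: nat
  assumes "a > 0" and "m > 1" and "coprime a m"
    and "n = a * m + 1"
    and "m dvd totient n \<longrightarrow> prime n"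
    and "\<forall>q. prime q \<and> q dvd m \<longrightarrow>
          (\<exists>b::int. [b ^ (n - 1) = 1] (mod int n) \<and>
                    \<not> [b ^ ((n - 1) div q) = 1] (mod int n))"
  shows "prime n"
proof -
  have n: "n > 0" "n - 1 > 0" "m dvd n - 1" using assms(1,2,4) by simp_all
  have "m dvd totient n"
  proof (rule multiplicity_le_imp_dvd)
    fix q :: nat assume q: "prime q"
    show "multiplicity q m \<le> multiplicity q (totient n)"
    proof (cases "q dvd m")
      case True
      then obtain b :: int where b: "[b ^ (n - 1) = 1] (mod int n)"
          "\<not> [b ^ ((n - 1) div q) = 1] (mod int n)"
        using assms(6) q by blast
      define d where "d = ord n (nat (b mod int n))"
      have d: "d dvd n - 1" "\<not> d dvd (n - 1) div q"
        using b unfolding d_def int_power_cong_1_iff_ord_dvd [OF n(1)] by blast+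
      \<comment> \<open>\<open>ord\<close> takes the default value 0 exactly when the base is not
        coprime to the modulus. Since 0 does not divide the positive number \<open>n - 1\<close>,
        the base is coprime to \<open>n\<close>, as needed for the order to divide
        \<open>totient n\<close>.\<close>
      have "d \<noteq> 0" using d(1) n(2) by (intro notI) simp
      then have "d dvd totient n"
        unfolding d_def by (intro order_divides_totient) (auto simp: ord_eq_0)
      have "multiplicity q m \<le> multiplicity q (n - 1)"
        using n by (intro dvd_imp_multiplicity_le) auto
      also have "\<dots> = multiplicity q d"
        using multiplicity_eq_if_not_dvd_div [OF q n(2) d] by simp
      also have "\<dots> \<le> multiplicity q (totient n)"
        using \<open>d dvd totient n\<close> n(1) by (intro dvd_imp_multiplicity_le) auto
      finally show ?thesis .
    qed (simp add: not_dvd_imp_multiplicity_0)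
  qed (use assms(2) in simp)
  with assms(5) show ?thesis by blast
qed

end
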